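(* Let $W$ be a weighted adjacency matrix of a graph $G$. Let $\lambda_1$ and $\lambda_n$ be the largest and the least eigenvalues of $W$, respectively. Let $\lambda\geq 0$ be a real number. Then the $\lambda$-clustering number of $G$ (with respect to $W$) is at least \[\frac{\lambda_1-\lambda_n}{\lambda-\lambda_n}.\]
   Context: Graphs are finite, simple and undirected. A weighted adjacency matrix of a graph $G=(V,E)$ on $n$ vertices is a real symmetric $n\times n$ matrix $W$, indexed by $V$, with $W_{i,j}=0$ whenever $(i,j)\notin E$ (in particular, zero diagonal). A partition $V=\dot\bigcup_{i=1}^k C_i$ of the vertex set into $k$ (nonempty) clusters is a $\lambda$-clustering of $G$ into $k$ clusters if \[\max_{i\in\{1,\ldots,k\}}\lambda_1(C_i)\ \leq\ \lambda,\] where $\lambda_1(C_i)$ is the largest eigenvalue of the weighted subgraph spanned by the vertices in $C_i$, i.e. of the principal submatrix of $W$ with rows and columns indexed by $C_i$. The $\lambda$-clustering number of $G$ is the minimal $k$ such that there exists a $\lambda$-clustering of $G$ into $k$ clusters. *)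

theory Defs
  imports
    Complex_Main
    "HOL-Library.Countable_Set"
    "HOL-Library.Disjoint_Sets"
    "Graph_Theory.Pair_Digraph"
    "Jordan_Normal_Form.Spectral_Radius"
begin

text \<open>
  A finite simple undirected graph is a \<^locale>\<open>pair_graph\<close>: a finite, symmetric, loop-free set of
  ordered pairs over a finite vertex set. Matrices indexed by vertices are functions of two vertices;
  only their values on the vertex set matter.
\<close>

definition weighted_adjacency :: "'a pair_pre_digraph \<Rightarrow> ('a \<Rightarrow> 'a \<Rightarrow> real) \<Rightarrow> bool" where
  "weighted_adjacency G W \<longleftrightarrow>
     (\<forall>i\<in>pverts G. \<forall>j\<in>pverts G. W i j = W j i) \<and>
     (\<forall>i\<in>pverts G. \<forall>j\<in>pverts G. (i, j) \<notin> parcs G \<longrightarrow> W i j = 0)"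

text \<open>
  The principal submatrix of \<open>W\<close> with rows and columns indexed by a finite set \<open>S\<close>. The function
  \<^const>\<open>from_nat_into\<close> maps \<open>{..<card S}\<close> bijectively onto \<open>S\<close>; the lemma
  \<open>eigenvalue_principal_mat_iff\<close> below shows that the eigenvalues do not depend on this enumeration.
\<close>

definition principal_mat :: "('a \<Rightarrow> 'a \<Rightarrow> real) \<Rightarrow> 'a set \<Rightarrow> real mat" where
  "principal_mat W S =
     mat (card S) (card S) (\<lambda>(i, j). W (from_nat_into S i) (from_nat_into S j))"

text \<open>Only meaningful for matrices of positive dimension whose real spectrum is nonempty, such as
  real symmetric ones.\<close>

definition largest_eigenvalue :: "real mat \<Rightarrow> real" where
  "largest_eigenvalue A = Max (spectrum A)"

definition least_eigenvalue :: "real mat \<Rightarrow> real" where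
  "least_eigenvalue A = Min (spectrum A)"

definition lambda_clustering ::
    "'a pair_pre_digraph \<Rightarrow> ('a \<Rightarrow> 'a \<Rightarrow> real) \<Rightarrow> real \<Rightarrow> 'a set set \<Rightarrow> bool" where
  "lambda_clustering G W lam P \<longleftrightarrow>
     partition_on (pverts G) P \<and> Max ((\<lambda>C. largest_eigenvalue (principal_mat W C)) ` P) \<le> lam"

definition lambda_clustering_number ::
    "'a pair_pre_digraph \<Rightarrow> ('a \<Rightarrow> 'a \<Rightarrow> real) \<Rightarrow> real \<Rightarrow> nat" where
  "lambda_clustering_number G W lam = (LEAST k. \<exists>P. lambda_clustering G W lam P \<and> card P = k)"

lemma eigenvalue_principal_mat_iff:
  assumes "finite S"
  shows "eigenvalue (principal_mat W S) \<mu> \<longleftrightarrow>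
    (\<exists>x. (\<exists>i\<in>S. x i \<noteq> 0) \<and> (\<forall>i\<in>S. (\<Sum>j\<in>S. W i j * x j) = \<mu> * x i))"
proof -
  let ?n = "card S" and ?f = "from_nat_into S"
  have f: "bij_betw ?f {..<?n} S"
    using assms by (rule bij_betw_from_nat_into_finite)
  have fS: "?f i \<in> S" if "i < ?n" for i
    using f that by (auto simp: bij_betw_def)
  have Sf: "\<exists>i<?n. s = ?f i" if "s \<in> S" for s
    using f that by (auto simp: bij_betw_def)
  have sum: "(\<Sum>j\<in>S. g j) = (\<Sum>j\<in>{0..<?n}. g (?f j))" for g :: "_ \<Rightarrow> real"
    using sum.reindex_bij_betw[OF f, of g] by (simp add: atLeast0LessThan)
  have row: "(principal_mat W S *\<^sub>v v) $ i = (\<Sum>j\<in>{0..<?n}. W (?f i) (?f j) * v $ j)"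
    if "v \<in> carrier_vec ?n" "i < ?n" for v i
    using that by (auto simp: principal_mat_def scalar_prod_def intro!: sum.cong)
  have dim: "dim_row (principal_mat W S) = ?n"
    by (simp add: principal_mat_def)
  show ?thesis
  proof
    assume "eigenvalue (principal_mat W S) \<mu>"
    then obtain v where v: "v \<in> carrier_vec ?n" "v \<noteq> 0\<^sub>v ?n"
      and eq: "principal_mat W S *\<^sub>v v = \<mu> \<cdot>\<^sub>v v"
      by (auto simp: eigenvalue_def eigenvector_def dim)
    define x where "x s = v $ (inv_into {..<?n} ?f s)" for s
    have x: "x (?f i) = v $ i" if "i < ?n" for i
      using f that by (simp add: x_def bij_betw_def)
    obtain i where i: "i < ?n" "v $ i \<noteq> 0"
      using v by (metis carrier_vecD eq_vecI index_zero_vec)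
    have "(\<Sum>j\<in>S. W s j * x j) = \<mu> * x s" if sS: "s \<in> S" for s
    proof -
      obtain k where k: "k < ?n" "s = ?f k" using Sf[OF sS] by auto
      have "(\<Sum>j\<in>S. W s j * x j) = (principal_mat W S *\<^sub>v v) $ k"
        unfolding sum row[OF v(1) k(1)] k(2) by (intro sum.cong) (auto simp: x)
      then show ?thesis using v k by (simp add: eq x)
    qed
    moreover have "\<exists>i\<in>S. x i \<noteq> 0"
      using fS[OF i(1)] x[OF i(1)] i(2) by metis
    ultimately show "\<exists>x. (\<exists>i\<in>S. x i \<noteq> 0) \<and> (\<forall>i\<in>S. (\<Sum>j\<in>S. W i j * x j) = \<mu> * x i)"
      by blast
  next
    assume "\<exists>x. (\<exists>i\<in>S. x i \<noteq> 0) \<and> (\<forall>i\<in>S. (\<Sum>j\<in>S. W i j * x j) = \<mu> * x i)"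
    then obtain x s where s: "s \<in> S" "x s \<noteq> 0"
      and eq: "\<And>i. i \<in> S \<Longrightarrow> (\<Sum>j\<in>S. W i j * x j) = \<mu> * x i" by blast
    define v where "v = vec ?n (\<lambda>i. x (?f i))"
    have v: "v \<in> carrier_vec ?n" by (simp add: v_def)
    obtain k where k: "k < ?n" "s = ?f k" using Sf[OF s(1)] by auto
    have "v $ k \<noteq> 0" using s k by (simp add: v_def)
    then have "v \<noteq> 0\<^sub>v ?n" using k(1) by auto
    moreover have "principal_mat W S *\<^sub>v v = \<mu> \<cdot>\<^sub>v v"
    proof (rule eq_vecI)
      fix i assume "i < dim_vec (\<mu> \<cdot>\<^sub>v v)"
      then have i: "i < ?n" by (simp add: v_def)
      have "(principal_mat W S *\<^sub>v v) $ i = (\<Sum>j\<in>S. W (?f i) j * x j)"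
        unfolding sum row[OF v i] by (intro sum.cong) (auto simp: v_def)
      then show "(principal_mat W S *\<^sub>v v) $ i = (\<mu> \<cdot>\<^sub>v v) $ i"
        using eq[OF fS[OF i]] i by (simp add: v_def)
    qed (simp add: v_def dim)
    ultimately show "eigenvalue (principal_mat W S) \<mu>"
      using v by (auto simp: eigenvalue_def eigenvector_def dim)
  qed
qed

text \<open>For \<open>lam \<ge> 0\<close> the partition into singletons is a clustering, so the minimum in
  \<^const>\<open>lambda_clustering_number\<close> is attained.\<close>

lemma lambda_clustering_number_attained:
  assumes "pair_graph G" "pverts G \<noteq> {}" "weighted_adjacency G W" "0 \<le> lam"
  shows "\<exists>P. lambda_clustering G W lam P \<and> card P = lambda_clustering_number G W lam"
proof -
  interpret pair_graph G by fact
  have zero: "W i i = 0" if "i \<in> pverts G" for i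
    using assms(3) that pair_no_loops[of "(i, i)"] by (auto simp: weighted_adjacency_def)
  have nz: "\<exists>x :: 'a \<Rightarrow> real. x i \<noteq> 0" for i
    by (rule exI[of _ "\<lambda>_. 1"]) simp
  have "spectrum (principal_mat W {i}) = {0}" if "i \<in> pverts G" for i
    unfolding spectrum_def using zero[OF that] nz[of i]
    by (auto simp: eigenvalue_principal_mat_iff)
  then have *: "largest_eigenvalue (principal_mat W {i}) = 0" if "i \<in> pverts G" for i
    using that by (simp add: largest_eigenvalue_def)
  let ?P = "(\<lambda>i. {i}) ` pverts G"
  have "partition_on (pverts G) ?P"
    by (auto simp: partition_on_def disjoint_def)
  moreover have "(\<lambda>C. largest_eigenvalue (principal_mat W C)) ` ?P = {0}"
    using * assms(2) by (auto simp: image_image)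
  ultimately have "lambda_clustering G W lam ?P"
    using assms(4) by (simp add: lambda_clustering_def)
  then have "\<exists>k P. lambda_clustering G W lam P \<and> card P = k" by blast
  then show ?thesis unfolding lambda_clustering_number_def by (rule LeastI_ex)
qed

end

theory Submission
  imports Defs "HOL-Analysis.Function_Topology"
begin

text \<open>
  Write \<open>m\<close> for the least eigenvalue of \<open>W\<close> and \<open>q\<close> for the quadratic form of \<open>W - m I\<close>. By the
  Rayleigh principle \<open>q\<close> is positive semidefinite, and such a form satisfies
  \<open>q (z\<^sub>1 + \<dots> + z\<^sub>k) \<le> k (q z\<^sub>1 + \<dots> + q z\<^sub>k)\<close>, since the difference of the two sides is the sum
  of \<open>q (z\<^sub>a - z\<^sub>b)\<close> over all pairs \<open>a < b\<close> (lemma \<open>psd_form_sum_le\<close>).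

  Let \<open>x\<close> be an eigenvector of \<open>W\<close> for its largest eigenvalue \<open>l\<close>, and cut it along a clustering
  into \<open>k\<close> clusters: \<open>x\<close> is the sum of its restrictions \<open>z\<^sub>C\<close> to the clusters \<open>C\<close>. The Rayleigh
  principle for the principal submatrix on \<open>C\<close> gives \<open>q z\<^sub>C \<le> (\<lambda> - m) \<bar>z\<^sub>C\<bar>\<^sup>2\<close>. The squared norms
  of the pieces add up to \<open>\<bar>x\<bar>\<^sup>2\<close>, and \<open>q x = (l - m) \<bar>x\<bar>\<^sup>2\<close>, so \<open>l - m \<le> k (\<lambda> - m)\<close>
  (lemma \<open>eigenvalue_gap_le_card_partition\<close>). Because the diagonal of \<open>W\<close> vanishes,
  \<open>m \<le> 0 \<le> \<lambda>\<close>, so that \<open>\<lambda> - m\<close> is never negative and division by it keeps the direction.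

  The Rayleigh principle itself comes from compactness: a maximiser \<open>x\<close> of the form on the unit
  sphere, with value \<open>M\<close>, is a null vector of the positive semidefinite matrix \<open>M I - W\<close>, and null
  vectors of a semidefinite matrix lie in its kernel (lemma \<open>psd_null_imp_kernel\<close>).
\<close>

section \<open>The bilinear form of a matrix\<close>

definition form :: "('a \<Rightarrow> 'a \<Rightarrow> real) \<Rightarrow> 'a set \<Rightarrow> ('a \<Rightarrow> real) \<Rightarrow> ('a \<Rightarrow> real) \<Rightarrow> real" where
  "form A S x y = (\<Sum>i\<in>S. \<Sum>j\<in>S. x i * A i j * y j)"

lemma form_add_left: "form A S (\<lambda>i. x i + y i) z = form A S x z + form A S y z"
  by (simp add: form_def algebra_simps sum.distrib)

lemma form_add_right: "form A S z (\<lambda>i. x i + y i) = form A S z x + form A S z y"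
  by (simp add: form_def algebra_simps sum.distrib)

lemma form_scale_left: "form A S (\<lambda>i. c * x i) z = c * form A S x z"
  by (simp add: form_def sum_distrib_left mult.assoc)

lemma form_scale_right: "form A S z (\<lambda>i. c * x i) = c * form A S z x"
  by (simp add: form_def sum_distrib_left mult_ac)

lemma form_sum_left: "form A S (\<lambda>i. \<Sum>k\<in>K. z k i) y = (\<Sum>k\<in>K. form A S (z k) y)"
proof -
  have "form A S (\<lambda>i. \<Sum>k\<in>K. z k i) y = (\<Sum>i\<in>S. \<Sum>j\<in>S. \<Sum>k\<in>K. z k i * A i j * y j)"
    by (simp add: form_def sum_distrib_right)
  also have "\<dots> = (\<Sum>i\<in>S. \<Sum>k\<in>K. \<Sum>j\<in>S. z k i * A i j * y j)"
    by (intro sum.cong refl sum.swap)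
  also have "\<dots> = (\<Sum>k\<in>K. \<Sum>i\<in>S. \<Sum>j\<in>S. z k i * A i j * y j)"
    by (rule sum.swap)
  finally show ?thesis by (simp add: form_def)
qed

lemma form_sum_right: "form A S y (\<lambda>i. \<Sum>k\<in>K. z k i) = (\<Sum>k\<in>K. form A S y (z k))"
proof -
  have "form A S y (\<lambda>i. \<Sum>k\<in>K. z k i) = (\<Sum>i\<in>S. \<Sum>j\<in>S. \<Sum>k\<in>K. y i * A i j * z k j)"
    by (simp add: form_def sum_distrib_left)
  also have "\<dots> = (\<Sum>i\<in>S. \<Sum>k\<in>K. \<Sum>j\<in>S. y i * A i j * z k j)"
    by (intro sum.cong refl sum.swap)
  also have "\<dots> = (\<Sum>k\<in>K. \<Sum>i\<in>S. \<Sum>j\<in>S. y i * A i j * z k j)"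
    by (rule sum.swap)
  finally show ?thesis by (simp add: form_def)
qed

lemma form_commute:
  assumes "\<forall>i\<in>S. \<forall>j\<in>S. A i j = A j i"
  shows "form A S x y = form A S y x"
proof -
  have "form A S x y = (\<Sum>i\<in>S. \<Sum>j\<in>S. y j * A j i * x i)"
    unfolding form_def using assms by (intro sum.cong refl) (simp add: mult_ac)
  also have "\<dots> = form A S y x"
    unfolding form_def by (rule sum.swap)
  finally show ?thesis .
qed

lemma form_cong:
  assumes "\<And>i. i \<in> S \<Longrightarrow> x i = x' i" "\<And>i. i \<in> S \<Longrightarrow> y i = y' i"
  shows "form A S x y = form A S x' y'"
  unfolding form_def using assms by (intro sum.cong refl) simp

text \<open>
  The affine combination \<open>c A + d I\<close> covers both matrices to which semidefiniteness is applied: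
  \<open>M I - A\<close> at a maximum \<open>M\<close> of the form of \<open>A\<close>, and \<open>A - m I\<close> for the least eigenvalue \<open>m\<close>.
\<close>

lemma form_shift:
  assumes "finite S"
  shows "form (\<lambda>i j. c * A i j + (if i = j then d else 0)) S x y
    = c * form A S x y + d * (\<Sum>i\<in>S. x i * y i)"
proof -
  have "(\<Sum>j\<in>S. x i * (c * A i j + (if i = j then d else 0)) * y j)
      = c * (\<Sum>j\<in>S. x i * A i j * y j) + d * (x i * y i)" if "i \<in> S" for i
  proof -
    have "(\<Sum>j\<in>S. x i * (c * A i j + (if i = j then d else 0)) * y j)
        = (\<Sum>j\<in>S. c * (x i * A i j * y j) + (if i = j then d * (x i * y j) else 0))"
      by (intro sum.cong refl) (simp add: algebra_simps)
    then show ?thesis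
      using assms that by (simp add: sum.distrib sum_distrib_left)
  qed
  then show ?thesis
    by (simp add: form_def sum.distrib sum_distrib_left)
qed

lemma form_eigenvector:
  assumes "\<forall>i\<in>S. (\<Sum>j\<in>S. A i j * x j) = \<mu> * x i"
  shows "form A S x x = \<mu> * (\<Sum>i\<in>S. (x i)\<^sup>2)"
proof -
  have "form A S x x = (\<Sum>i\<in>S. x i * (\<Sum>j\<in>S. A i j * x j))"
    by (simp add: form_def sum_distrib_left mult.assoc)
  also have "\<dots> = (\<Sum>i\<in>S. \<mu> * (x i)\<^sup>2)"
    using assms by (intro sum.cong refl) (simp add: power2_eq_square)
  finally show ?thesis by (simp add: sum_distrib_left)
qed

text \<open>
  Extending a vector by zero turns the form of a principal submatrix into that of the whole matrix.
\<close>

lemma form_restrict: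
  assumes "finite S" "C \<subseteq> S"
  shows "form A S (\<lambda>i. if i \<in> C then x i else 0) (\<lambda>i. if i \<in> C then x i else 0) = form A C x x"
proof -
  have "form A S (\<lambda>i. if i \<in> C then x i else 0) (\<lambda>i. if i \<in> C then x i else 0)
      = (\<Sum>i\<in>S. if i \<in> C then \<Sum>j\<in>S. if j \<in> C then x i * A i j * x j else 0 else 0)"
    unfolding form_def by (intro sum.cong refl) (auto intro!: sum.cong)
  also have "\<dots> = form A C x x"
    using assms by (simp add: form_def sum.inter_restrict[symmetric] Int_absorb1)
  finally show ?thesis .
qed

section \<open>Positive semidefinite forms\<close>

text \<open>
  At a null vector \<open>x\<close> the form attains its minimum 0, so its derivative in each coordinate
  direction vanishes.
\<close>

lemma psd_null_imp_kernel:
  assumes fin: "finite S" and sym: "\<forall>i\<in>S. \<forall>j\<in>S. A i j = A j i"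
    and psd: "\<And>y. 0 \<le> form A S y y" and null: "form A S x x = 0" and "i \<in> S"
  shows "(\<Sum>j\<in>S. A i j * x j) = 0"
proof -
  define e where "e = (\<lambda>j. if j = i then 1 else 0 :: real)"
  define b where "b = form A S e x"
  define c where "c = form A S e e"
  have "c \<ge> 0" using psd by (simp add: c_def)
  have quad: "0 \<le> 2 * t * b + t\<^sup>2 * c" for t
  proof -
    have "form A S x e = b"
      using form_commute[OF sym] by (simp add: b_def)
    then have "form A S (\<lambda>j. x j + t * e j) (\<lambda>j. x j + t * e j) = 2 * t * b + t\<^sup>2 * c"
      using null by (simp add: form_add_left form_add_right form_scale_left form_scale_right
          b_def[symmetric] c_def[symmetric] algebra_simps power2_eq_square)
    then show ?thesis using psd by metis
  qed
  \<comment> \<open>Near the minimiser \<open>- b / c\<close> of the quadratic, but well defined also when \<open>c = 0\<close>.\<close>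
  define t where "t = - b / (c + 1)"
  have b: "b = - (t * (c + 1))" using \<open>c \<ge> 0\<close> by (simp add: t_def)
  have "2 * t * b + t\<^sup>2 * c = - (t\<^sup>2 * (c + 2))"
    unfolding b by (simp add: algebra_simps power2_eq_square)
  with quad[of t] have "t\<^sup>2 * (c + 2) \<le> 0" by simp
  with \<open>c \<ge> 0\<close> have "t = 0" by (simp add: mult_le_0_iff)
  then have "b = 0" by (simp add: b)
  moreover have "b = (\<Sum>j\<in>S. A i j * x j)"
  proof -
    have "b = (\<Sum>k\<in>S. if k = i then \<Sum>j\<in>S. A k j * x j else 0)"
      unfolding b_def form_def e_def by (intro sum.cong refl) simp
    then show ?thesis using fin \<open>i \<in> S\<close> by simp
  qed
  ultimately show ?thesis by simp
qed

text \<open>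
  Convexity of a semidefinite form, scaled to avoid averages. Semidefiniteness at \<open>z\<^sub>k - z\<^sub>l\<close> bounds
  the cross term of \<open>z\<^sub>k\<close> and \<open>z\<^sub>l\<close> by the mean of their two diagonal terms; summing over all
  ordered pairs counts each diagonal term \<open>card K\<close> times.
\<close>

lemma psd_form_sum_le:
  assumes sym: "\<forall>i\<in>S. \<forall>j\<in>S. A i j = A j i" and psd: "\<And>y. 0 \<le> form A S y y"
  shows "form A S (\<lambda>i. \<Sum>k\<in>K. z k i) (\<lambda>i. \<Sum>k\<in>K. z k i)
    \<le> card K * (\<Sum>k\<in>K. form A S (z k) (z k))"
proof -
  let ?q = "\<lambda>k. form A S (z k) (z k)"
  have "2 * form A S (z k) (z l) \<le> ?q k + ?q l" for k l
  proof -
    have "0 \<le> form A S (\<lambda>i. z k i + (-1) * z l i) (\<lambda>i. z k i + (-1) * z l i)"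
      by (rule psd)
    then show ?thesis
      unfolding form_add_left form_add_right form_scale_left form_scale_right
      using form_commute[OF sym, of "z k" "z l"] by linarith
  qed
  then have "(\<Sum>k\<in>K. \<Sum>l\<in>K. 2 * form A S (z k) (z l)) \<le> (\<Sum>k\<in>K. \<Sum>l\<in>K. ?q k + ?q l)"
    by (intro sum_mono)
  also have "\<dots> = 2 * (card K * (\<Sum>k\<in>K. ?q k))"
    by (simp add: sum.distrib flip: sum_distrib_left)
  also have "(\<Sum>k\<in>K. \<Sum>l\<in>K. 2 * form A S (z k) (z l))
      = 2 * (\<Sum>k\<in>K. \<Sum>l\<in>K. form A S (z k) (z l))"
    by (simp only: sum_distrib_left)
  finally have "(\<Sum>k\<in>K. \<Sum>l\<in>K. form A S (z k) (z l)) \<le> card K * (\<Sum>k\<in>K. ?q k)"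
    by simp
  moreover have "form A S (\<lambda>i. \<Sum>k\<in>K. z k i) (\<lambda>i. \<Sum>k\<in>K. z k i)
      = (\<Sum>k\<in>K. \<Sum>l\<in>K. form A S (z k) (z l))"
    by (simp add: form_sum_left form_sum_right)
  ultimately show ?thesis by simp
qed

section \<open>The Rayleigh principle\<close>

text \<open>
  Vectors on \<open>S\<close> are normalised to vanish outside \<open>S\<close>: then the sphere is a closed subset of a
  product of compact intervals and singletons, and Tychonoff's theorem applies.
\<close>

lemma unit_sphere_compact:
  assumes fin: "finite S"
  shows "compact {x :: 'a \<Rightarrow> real. (\<forall>i. i \<notin> S \<longrightarrow> x i = 0) \<and> (\<Sum>i\<in>S. (x i)\<^sup>2) = 1}"
    (is "compact ?X")
proof -
  define K where "K i = (if i \<in> S then {-1..1} else {0 :: real})" for i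
  have "compactin (product_topology (\<lambda>_. euclidean) UNIV) (PiE UNIV K)"
    by (auto simp: compactin_PiE K_def)
  then have K: "compact (PiE UNIV K)"
    by (simp add: euclidean_product_topology)
  have cl: "closed {x :: 'a \<Rightarrow> real. (\<Sum>i\<in>S. (x i)\<^sup>2) = 1}"
    by (intro closed_Collect_eq continuous_intros continuous_on_product_coordinates)
  have "x i \<in> {-1..1}" if "(\<Sum>i\<in>S. (x i)\<^sup>2) = 1" "i \<in> S" for x :: "'a \<Rightarrow> real" and i
  proof -
    have "(x i)\<^sup>2 \<le> (\<Sum>i\<in>S. (x i)\<^sup>2)"
      using fin that(2) by (intro member_le_sum) auto
    then show ?thesis using that(1) by (simp add: abs_square_le_1 abs_le_iff)
  qed
  then have "?X = PiE UNIV K \<inter> {x. (\<Sum>i\<in>S. (x i)\<^sup>2) = 1}"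
    by (auto simp: K_def PiE_iff split: if_splits)
  then show ?thesis using compact_Int_closed[OF K cl] by simp
qed

text \<open>
  The maximum of the form on the unit sphere is an eigenvalue: a maximiser is a null vector of the
  positive semidefinite matrix \<open>M I - A\<close>, hence in its kernel.
\<close>

lemma rayleigh_max_eigenvalue:
  assumes fin: "finite S" and ne: "S \<noteq> {}" and sym: "\<forall>i\<in>S. \<forall>j\<in>S. A i j = A j i"
  obtains M where "eigenvalue (principal_mat A S) M"
    and "\<And>y. form A S y y \<le> M * (\<Sum>i\<in>S. (y i)\<^sup>2)"
proof -
  define X where "X = {x :: 'a \<Rightarrow> real. (\<forall>i. i \<notin> S \<longrightarrow> x i = 0) \<and> (\<Sum>i\<in>S. (x i)\<^sup>2) = 1}"
  have compX: "compact X" unfolding X_def by (rule unit_sphere_compact[OF fin])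
  obtain s where s: "s \<in> S" using ne by blast
  have "(\<lambda>i. if i = s then 1 else 0) \<in> X"
    using s fin by (simp add: X_def if_distrib[of "\<lambda>t. t\<^sup>2"] cong: if_cong)
  moreover have "continuous_on X (\<lambda>x. form A S x x)"
    unfolding form_def
    by (intro continuous_intros continuous_on_subset[OF continuous_on_product_coordinates]) auto
  ultimately obtain x where x: "x \<in> X" and max: "\<And>y. y \<in> X \<Longrightarrow> form A S y y \<le> form A S x x"
    using continuous_attains_sup[of X "\<lambda>x. form A S x x"] compX by auto
  define M where "M = form A S x x"
  have bound: "form A S y y \<le> M * (\<Sum>i\<in>S. (y i)\<^sup>2)" for y
  proof (cases "(\<Sum>i\<in>S. (y i)\<^sup>2) = 0")
    case True
    then have "form A S y y = form A S (\<lambda>_. 0) (\<lambda>_. 0)"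
      using fin by (intro form_cong) (auto simp: sum_nonneg_eq_0_iff)
    then show ?thesis using True by (simp add: form_def)
  next
    case False
    define r where "r = sqrt (\<Sum>i\<in>S. (y i)\<^sup>2)"
    have pos: "(\<Sum>i\<in>S. (y i)\<^sup>2) > 0"
      using False by (simp add: order_less_le sum_nonneg)
    then have r: "r > 0" "r\<^sup>2 = (\<Sum>i\<in>S. (y i)\<^sup>2)" by (simp_all add: r_def)
    \<comment> \<open>The normalisation of \<open>y\<close>, cut off outside \<open>S\<close> as membership in \<open>X\<close> demands.\<close>
    define u where "u = (\<lambda>i. if i \<in> S then (1 / r) * y i else 0)"
    have "(\<Sum>i\<in>S. (u i)\<^sup>2) = (1 / r\<^sup>2) * (\<Sum>i\<in>S. (y i)\<^sup>2)"
      unfolding sum_distrib_left by (intro sum.cong refl) (simp add: u_def power_divide)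
    also have "\<dots> = 1" using r pos by simp
    finally have "u \<in> X" by (simp add: X_def u_def)
    then have "form A S u u \<le> M" using max M_def by simp
    moreover have "form A S u u = form A S (\<lambda>i. (1 / r) * y i) (\<lambda>i. (1 / r) * y i)"
      by (intro form_cong) (auto simp: u_def)
    ultimately have "form A S y y / r\<^sup>2 \<le> M"
      by (simp only: form_scale_left form_scale_right) (simp add: power2_eq_square)
    then show ?thesis using pos r(2) by (simp add: pos_divide_le_eq)
  qed
  define B where "B = (\<lambda>i j. -1 * A i j + (if i = j then M else 0))"
  have formB: "form B S y y = M * (\<Sum>i\<in>S. (y i)\<^sup>2) - form A S y y" for y
    unfolding B_def form_shift[OF fin] by (simp add: power2_eq_square)
  have ev: "(\<Sum>j\<in>S. A i j * x j) = M * x i" if "i \<in> S" for i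
  proof -
    have "(\<Sum>j\<in>S. B i j * x j) = 0"
    proof (rule psd_null_imp_kernel[OF fin _ _ _ that])
      show "\<forall>i\<in>S. \<forall>j\<in>S. B i j = B j i" using sym by (simp add: B_def)
      show "0 \<le> form B S y y" for y using bound[of y] by (simp add: formB)
      show "form B S x x = 0" using x by (simp add: formB X_def M_def)
    qed
    moreover have "(\<Sum>j\<in>S. B i j * x j)
        = (\<Sum>j\<in>S. (if i = j then M * x j else 0) - A i j * x j)"
      unfolding B_def by (intro sum.cong refl) (simp add: algebra_simps)
    ultimately show ?thesis using fin that by (simp add: sum_subtractf)
  qed
  have "\<exists>i\<in>S. x i \<noteq> 0"
  proof (rule ccontr)
    assume "\<not> (\<exists>i\<in>S. x i \<noteq> 0)"
    then have "(\<Sum>i\<in>S. (x i)\<^sup>2) = 0" by simp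
    then show False using x by (simp add: X_def)
  qed
  with ev have "eigenvalue (principal_mat A S) M"
    unfolding eigenvalue_principal_mat_iff[OF fin] by blast
  then show thesis using bound that by blast
qed

lemma finite_spectrum_principal_mat: "finite (spectrum (principal_mat A S))"
  by (rule card_finite_spectrum(1)[of _ "card S"]) (simp add: principal_mat_def)

lemma form_le_largest_eigenvalue:
  assumes "finite S" "S \<noteq> {}" "\<forall>i\<in>S. \<forall>j\<in>S. A i j = A j i"
  shows "form A S y y \<le> largest_eigenvalue (principal_mat A S) * (\<Sum>i\<in>S. (y i)\<^sup>2)"
proof -
  obtain M where M: "eigenvalue (principal_mat A S) M"
    and le: "form A S y y \<le> M * (\<Sum>i\<in>S. (y i)\<^sup>2)"
    using rayleigh_max_eigenvalue[OF assms] by metis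
  have "M \<le> largest_eigenvalue (principal_mat A S)"
    unfolding largest_eigenvalue_def using M
    by (intro Max_ge finite_spectrum_principal_mat) (simp add: spectrum_def)
  then have "M * (\<Sum>i\<in>S. (y i)\<^sup>2) \<le> largest_eigenvalue (principal_mat A S) * (\<Sum>i\<in>S. (y i)\<^sup>2)"
    by (intro mult_right_mono sum_nonneg) auto
  with le show ?thesis by linarith
qed

text \<open>The Rayleigh principle for \<open>- A\<close>, whose eigenvalues are the negatives of those of \<open>A\<close>.\<close>

lemma form_ge_least_eigenvalue:
  assumes "finite S" "S \<noteq> {}" "\<forall>i\<in>S. \<forall>j\<in>S. A i j = A j i"
  shows "least_eigenvalue (principal_mat A S) * (\<Sum>i\<in>S. (y i)\<^sup>2) \<le> form A S y y"
proof -
  define N where "N = (\<lambda>i j. - A i j)"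
  have "\<forall>i\<in>S. \<forall>j\<in>S. N i j = N j i" using assms(3) by (simp add: N_def)
  then obtain M where M: "eigenvalue (principal_mat N S) M"
    and le: "form N S y y \<le> M * (\<Sum>i\<in>S. (y i)\<^sup>2)"
    using rayleigh_max_eigenvalue[OF assms(1,2)] by metis
  have "eigenvalue (principal_mat A S) (- M)"
    using M unfolding eigenvalue_principal_mat_iff[OF assms(1)]
    by (simp add: N_def sum_negf minus_equation_iff) (metis minus_equation_iff)
  then have "least_eigenvalue (principal_mat A S) \<le> - M"
    unfolding least_eigenvalue_def
    by (intro Min_le finite_spectrum_principal_mat) (simp add: spectrum_def)
  then have "least_eigenvalue (principal_mat A S) * (\<Sum>i\<in>S. (y i)\<^sup>2) \<le> - M * (\<Sum>i\<in>S. (y i)\<^sup>2)"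
    by (intro mult_right_mono sum_nonneg) auto
  moreover have "form N S y y = - form A S y y"
    by (simp add: N_def form_def sum_negf)
  ultimately show ?thesis using le by simp
qed

text \<open>The diagonal entry is the Rayleigh quotient of a unit coordinate vector.\<close>

lemma least_eigenvalue_le_diagonal:
  assumes "finite S" "\<forall>i\<in>S. \<forall>j\<in>S. A i j = A j i" "s \<in> S"
  shows "least_eigenvalue (principal_mat A S) \<le> A s s"
proof -
  let ?e = "\<lambda>i. if i \<in> {s} then 1 else 0 :: real"
  have "form A S ?e ?e = A s s"
    using form_restrict[OF assms(1), of "{s}" A "\<lambda>_. 1"] assms(3) by (simp add: form_def)
  moreover have "(\<Sum>i\<in>S. (?e i)\<^sup>2) = 1"
    using assms(1,3) by (simp add: if_distrib[of "\<lambda>t. t\<^sup>2"] cong: if_cong)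
  ultimately show ?thesis
    using form_ge_least_eigenvalue[OF assms(1) _ assms(2), of ?e] assms(3) by auto
qed

text \<open>
  The Rayleigh principle shows that the spectrum is nonempty, so its maximum is an eigenvalue.
\<close>

lemma largest_eigenvector:
  assumes "finite S" "S \<noteq> {}" "\<forall>i\<in>S. \<forall>j\<in>S. A i j = A j i"
  obtains x where "\<exists>i\<in>S. x i \<noteq> 0"
    and "\<forall>i\<in>S. (\<Sum>j\<in>S. A i j * x j) = largest_eigenvalue (principal_mat A S) * x i"
proof -
  obtain M where "eigenvalue (principal_mat A S) M"
    using rayleigh_max_eigenvalue[OF assms] by metis
  then have "largest_eigenvalue (principal_mat A S) \<in> spectrum (principal_mat A S)"
    unfolding largest_eigenvalue_def using finite_spectrum_principal_mat
    by (intro Max_in) (auto simp: spectrum_def)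
  then show thesis
    using that by (auto simp: spectrum_def eigenvalue_principal_mat_iff[OF assms(1)])
qed

section \<open>The bound on clusterings\<close>

text \<open>
  The eigenvector for the largest eigenvalue, cut into its restrictions to the parts, is fed into
  the convexity of the form of \<open>A - m I\<close>, where \<open>m\<close> is the least eigenvalue. Each part contributes
  at most \<open>lam - m\<close> times its share of the squared norm.
\<close>

lemma eigenvalue_gap_le_card_partition:
  assumes fin: "finite V" and ne: "V \<noteq> {}" and sym: "\<forall>i\<in>V. \<forall>j\<in>V. A i j = A j i"
    and part: "partition_on V P"
    and le: "\<And>C. C \<in> P \<Longrightarrow> largest_eigenvalue (principal_mat A C) \<le> lam"
  shows "largest_eigenvalue (principal_mat A V) - least_eigenvalue (principal_mat A V)
    \<le> card P * (lam - least_eigenvalue (principal_mat A V))"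
proof -
  define l where "l = largest_eigenvalue (principal_mat A V)"
  define m where "m = least_eigenvalue (principal_mat A V)"
  have finP: "finite P" using fin part finite_elements by blast
  have sub: "C \<subseteq> V" if "C \<in> P" for C using part that by (auto simp: partition_on_def)
  have finC: "finite C" if "C \<in> P" for C using sub[OF that] fin by (rule finite_subset)
  obtain x where x0: "\<exists>i\<in>V. x i \<noteq> 0" and x: "\<forall>i\<in>V. (\<Sum>j\<in>V. A i j * x j) = l * x i"
    using largest_eigenvector[OF fin ne sym] unfolding l_def by metis
  define B where "B = (\<lambda>i j. 1 * A i j + (if i = j then - m else 0))"
  have formB: "form B S y y = form A S y y - m * (\<Sum>i\<in>S. (y i)\<^sup>2)" if "finite S" for y S
    unfolding B_def form_shift[OF that] by (simp add: power2_eq_square)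
  have symB: "\<forall>i\<in>V. \<forall>j\<in>V. B i j = B j i" using sym by (simp add: B_def)
  have psd: "0 \<le> form B V y y" for y
    using form_ge_least_eigenvalue[OF fin ne sym, of y] by (simp add: formB[OF fin] m_def)
  define z where "z C i = (if i \<in> C then x i else 0)" for C i
  have z: "(\<Sum>C\<in>P. z C i) = x i" if "i \<in> V" for i
  proof -
    obtain D where D: "D \<in> P" "i \<in> D" using part \<open>i \<in> V\<close> by (auto simp: partition_on_def)
    have "z C i = (if C = D then x i else 0)" if "C \<in> P" for C
      using part D that unfolding z_def partition_on_def disjoint_def by fastforce
    then show ?thesis using D finP by simp
  qed
  have norm: "(\<Sum>C\<in>P. \<Sum>i\<in>C. (x i)\<^sup>2) = (\<Sum>i\<in>V. (x i)\<^sup>2)"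
    using sum.Union_disjoint_sets[of P "\<lambda>i. (x i)\<^sup>2"] part finC
    by (simp add: partition_on_def)
  have cluster: "form B V (z C) (z C) \<le> (lam - m) * (\<Sum>i\<in>C. (x i)\<^sup>2)" if "C \<in> P" for C
  proof -
    have C: "finite C" "C \<noteq> {}" "\<forall>i\<in>C. \<forall>j\<in>C. A i j = A j i"
      using that part sub[OF that] finC[OF that] sym by (auto simp: partition_on_def)
    have "form B V (z C) (z C) = form A C x x - m * (\<Sum>i\<in>C. (x i)\<^sup>2)"
      unfolding z_def form_restrict[OF fin sub[OF that]] by (rule formB[OF C(1)])
    moreover have "form A C x x \<le> largest_eigenvalue (principal_mat A C) * (\<Sum>i\<in>C. (x i)\<^sup>2)"
      by (rule form_le_largest_eigenvalue[OF C])
    moreover have "\<dots> \<le> lam * (\<Sum>i\<in>C. (x i)\<^sup>2)"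
      using le[OF that] by (intro mult_right_mono sum_nonneg) auto
    ultimately show ?thesis by (simp add: algebra_simps)
  qed
  have "(l - m) * (\<Sum>i\<in>V. (x i)\<^sup>2) = form B V x x"
    using form_eigenvector[OF x] by (simp add: formB[OF fin] algebra_simps)
  also have "\<dots> = form B V (\<lambda>i. \<Sum>C\<in>P. z C i) (\<lambda>i. \<Sum>C\<in>P. z C i)"
    using z by (intro form_cong) auto
  also have "\<dots> \<le> card P * (\<Sum>C\<in>P. form B V (z C) (z C))"
    by (rule psd_form_sum_le[OF symB psd])
  also have "\<dots> \<le> card P * (\<Sum>C\<in>P. (lam - m) * (\<Sum>i\<in>C. (x i)\<^sup>2))"
    using cluster by (intro mult_left_mono sum_mono) auto
  also have "\<dots> = (card P * (lam - m)) * (\<Sum>i\<in>V. (x i)\<^sup>2)"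
    by (simp add: sum_distrib_left[symmetric] norm)
  finally have "(l - m) * (\<Sum>i\<in>V. (x i)\<^sup>2) \<le> (card P * (lam - m)) * (\<Sum>i\<in>V. (x i)\<^sup>2)" .
  moreover have "(\<Sum>i\<in>V. (x i)\<^sup>2) > 0"
    using x0 fin by (metis sum_pos2 zero_le_power2 zero_less_power2)
  ultimately show ?thesis by (simp add: l_def m_def)
qed

theorem theorem3:
  fixes G :: "'a pair_pre_digraph"
    and W :: "'a \<Rightarrow> 'a \<Rightarrow> real"
    and lam :: real
  assumes "pair_graph G"
    and "pverts G \<noteq> {}"
    and "weighted_adjacency G W"
    and "lam \<ge> 0"
  shows "let lam\<^sub>1 = largest_eigenvalue (principal_mat W (pverts G));
             lam\<^sub>n = least_eigenvalue (principal_mat W (pverts G))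
         in real (lambda_clustering_number G W lam) \<ge> (lam\<^sub>1 - lam\<^sub>n) / (lam - lam\<^sub>n)"
proof -
  interpret pair_graph G by fact
  define l where "l = largest_eigenvalue (principal_mat W (pverts G))"
  define m where "m = least_eigenvalue (principal_mat W (pverts G))"
  have fin: "finite (pverts G)" by (rule pair_finite_verts)
  have sym: "\<forall>i\<in>pverts G. \<forall>j\<in>pverts G. W i j = W j i"
    using assms(3) by (simp add: weighted_adjacency_def)
  obtain P where P: "lambda_clustering G W lam P" and k: "card P = lambda_clustering_number G W lam"
    using lambda_clustering_number_attained[OF assms] by blast
  have part: "partition_on (pverts G) P"
    using P by (simp add: lambda_clustering_def)
  have "finite P" using part fin finite_elements by blast
  then have "largest_eigenvalue (principal_mat W C) \<le> lam" if "C \<in> P" for C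
    using P that unfolding lambda_clustering_def
    by (meson Max_ge finite_imageI imageI order_trans)
  then have gap: "l - m \<le> card P * (lam - m)"
    unfolding l_def m_def by (rule eigenvalue_gap_le_card_partition[OF fin assms(2) sym part])
  obtain s where s: "s \<in> pverts G" using assms(2) by blast
  have "W s s = 0"
    using assms(3) s pair_no_loops[of "(s, s)"] by (auto simp: weighted_adjacency_def)
  then have "m \<le> 0"
    using least_eigenvalue_le_diagonal[OF fin sym s] by (simp add: m_def)
  have "(l - m) / (lam - m) \<le> card P"
  \<comment> \<open>If \<open>lam = m\<close>, the quotient is 0 by the convention for division by zero.\<close>
  proof (cases "lam = m")
    case False
    then have "lam - m > 0" using \<open>m \<le> 0\<close> assms(4) by simp
    then show ?thesis using gap by (simp add: pos_divide_le_eq)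
  qed simp
  then show ?thesis by (simp add: Let_def k l_def m_def)
qed

end
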